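(* The category $\mathbf{S}\text{-}\mathbf{Top}_r$ of strong $R$-spaces and continuous mappings is not reflective in the category $\mathbf{Top}_0$ of $T_0$-spaces and continuous mappings.
   Context: For a $T_0$-space $X$: a subset is saturated if it equals the intersection of all open sets containing it; $Q(X)$ is the set of all nonempty compact saturated subsets of $X$ (compactness is the open-cover property). A $T_0$-space $X$ is a strong $R$-space if for every nonempty family $\{K_i: i\in I\}\subseteq Q(X)$ and every open $U\subseteq X$, $\bigcap_{i\in I}K_i\subseteq U$ implies $\bigcap_{i\in J}K_i\subseteq U$ for some nonempty finite $J\subseteq I$. $\mathbf{S}\text{-}\mathbf{Top}_r$ is the full subcategory of $\mathbf{Top}_0$ whose objects are the strong $R$-spaces. A full subcategory $\mathbf{K}$ of $\mathbf{Top}_0$ is reflective in $\mathbf{Top}_0$ if every $T_0$-space $X$ has a $\mathbf{K}$-reflection, i.e. a pair $\langle\widetilde X,\eta_X\rangle$ with $\widetilde X$ an object of $\mathbf{K}$ and $\eta_X:X\to\widetilde X$ continuous such that for every continuous $f:X\to Y$ to an object $Y$ of $\mathbf{K}$ there is a unique continuous $f^{*}:\widetilde X\to Y$ with $f^{*}\circ\eta_X=f$. *)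

theory Defs
  imports "HOL-Analysis.Analysis"
begin

definition saturated_in :: "'a topology \<Rightarrow> 'a set \<Rightarrow> bool" where
  "saturated_in X S \<longleftrightarrow> S \<subseteq> topspace X \<and> S = \<Inter> {U. openin X U \<and> S \<subseteq> U}"

definition compact_saturated_sets :: "'a topology \<Rightarrow> 'a set set" where
  "compact_saturated_sets X = {K. K \<noteq> {} \<and> compactin X K \<and> saturated_in X K}"

definition strong_R_space :: "'a topology \<Rightarrow> bool" where
  "strong_R_space X \<longleftrightarrow> t0_space X \<and>
     (\<forall>\<K> U. \<K> \<noteq> {} \<and> \<K> \<subseteq> compact_saturated_sets X \<and> openin X U \<and> \<Inter>\<K> \<subseteq> U \<longrightarrow>
        (\<exists>\<F>. \<F> \<noteq> {} \<and> finite \<F> \<and> \<F> \<subseteq> \<K> \<and> \<Inter>\<F> \<subseteq> U))"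

text \<open>
  A full subcategory of the category of \<open>T\<^sub>0\<close>-spaces is given by the predicate \<open>K\<close> that
  selects its objects. As \<open>continuous_map\<close> does not constrain a function outside the
  carrier of its domain, the mediating morphism is required to be extensional; this makes
  \<open>\<exists>!\<close> express uniqueness of morphisms.
\<close>

definition reflection_in ::
  "('u topology \<Rightarrow> bool) \<Rightarrow> 'a topology \<Rightarrow> 'u topology \<Rightarrow> ('a \<Rightarrow> 'u) \<Rightarrow> bool" where
  "reflection_in K X Z \<eta> \<longleftrightarrow>
     K Z \<and> continuous_map X Z \<eta> \<and>
     (\<forall>Y f. K Y \<and> continuous_map X Y f \<longrightarrow>
        (\<exists>!g. g \<in> extensional (topspace Z) \<and> continuous_map Z Y g \<and>
              (\<forall>x\<in>topspace X. g (\<eta> x) = f x)))"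

text \<open>
  HOL cannot quantify over all types inside a formula. Here \<open>'u\<close> bounds the points of
  the objects of the subcategory (both the candidate reflections and the spaces against
  which they are tested), and \<open>'a\<close>, which may or may not equal \<open>'u\<close>, bounds the points
  of the spaces to be reflected. For \<open>'a = 'u\<close> this is reflectivity inside one universe of
  spaces. Failure for a fixed \<open>'a\<close> and all infinite \<open>'u\<close> excludes reflectivity in the
  class of all \<open>T\<^sub>0\<close>-spaces: the spaces over \<open>'a\<close> form a set, so reflections of them
  of whatever size would all fit into a single sufficiently large \<open>'u\<close>.
\<close>

definition reflective_in_Top0 :: "'a itself \<Rightarrow> ('u topology \<Rightarrow> bool) \<Rightarrow> bool" where
  "reflective_in_Top0 T K \<longleftrightarrow>
     (\<forall>X :: 'a topology. t0_space X \<longrightarrow> (\<exists>Z \<eta>. reflection_in K X Z \<eta>))"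

end

theory Submission
  imports Defs
begin

text \<open>
  A full subcategory that is reflective in \<open>T\<^sub>0\<close>-spaces is closed under equalizers: the
  reflection of an equalizer \<open>X\<close> of \<open>f, g : Y \<rightarrow> W\<close> is mapped by the extension of the
  inclusion \<open>X \<rightarrow> Y\<close> back into \<open>X\<close>, which makes it homeomorphic to \<open>X\<close>. Strong
  \<open>R\<close>-spaces are not closed under equalizers. Take a convergent sequence \<open>High n \<longlonglongrightarrow> Lim\<close> and
  put below it points \<open>Low i\<close>, where \<open>Low i\<close> has the least neighbourhood
  \<open>K\<^sub>i = {Low i, Lim} \<union> {High n | n > i}\<close>. This is a strong \<open>R\<close>-space, since
  whenever \<open>\<Inter>\<K> \<subseteq> U\<close>, some \<open>K \<in> \<K>\<close> has \<open>K - U\<close> finite. But without \<open>Lim\<close>, a subspace that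
  is an equalizer of two endomaps, the compact saturated sets \<open>K\<^sub>i - {Lim}\<close> have the finite
  intersection property and empty intersection.
\<close>

section \<open>Reflections and equalizers\<close>

text \<open>The uniqueness clause of a reflection concerns extensional maps, so it is applied to the
  restrictions of \<open>p\<close> and \<open>q\<close> to \<open>topspace Z\<close>, both of which
  mediate \<open>p \<circ> \<eta>\<close>.\<close>

lemma reflection_in_unique:
  assumes "reflection_in K X Z \<eta>" "K Y" "continuous_map Z Y p" "continuous_map Z Y q"
    and "\<And>x. x \<in> topspace X \<Longrightarrow> p (\<eta> x) = q (\<eta> x)" and "z \<in> topspace Z"
  shows "p z = q z"
proof -
  have \<eta>: "continuous_map X Z \<eta>"
    using assms(1) by (simp add: reflection_in_def)
  then have \<eta>': "\<eta> x \<in> topspace Z" if "x \<in> topspace X" for x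
    using that continuous_map_image_subset_topspace by blast
  let ?P = "\<lambda>g. g \<in> extensional (topspace Z) \<and> continuous_map Z Y g \<and>
    (\<forall>x\<in>topspace X. g (\<eta> x) = (p \<circ> \<eta>) x)"
  have "continuous_map X Y (p \<circ> \<eta>)"
    using \<eta> assms(3) continuous_map_compose by blast
  then have "\<exists>!g. ?P g"
    using assms(1,2) unfolding reflection_in_def by blast
  moreover have "continuous_map Z Y (restrict p (topspace Z))"
    "continuous_map Z Y (restrict q (topspace Z))"
    using assms(3,4) by (auto intro: continuous_map_eq)
  then have "?P (restrict p (topspace Z))" "?P (restrict q (topspace Z))"
    using \<eta>' assms(5) by simp_all
  ultimately have "restrict p (topspace Z) = restrict q (topspace Z)"
    by blast
  then show ?thesis
    using assms(6) by (metis restrict_apply')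
qed

lemma reflection_in_equalizer_homeomorphic:
  assumes refl: "reflection_in K X Z \<eta>" and "K Y" "K W"
    and e: "embedding_map X Y e"
    and f: "continuous_map Y W f" and g: "continuous_map Y W g"
    and eq: "e ` topspace X = {y \<in> topspace Y. f y = g y}"
  shows "X homeomorphic_space Z"
proof -
  have \<eta>: "continuous_map X Z \<eta>" and "K Z"
    using refl by (simp_all add: reflection_in_def)
  have "continuous_map X Y e"
    using e by (auto simp: embedding_map_def continuous_map_in_subtopology
        dest: homeomorphic_imp_continuous_map)
  then obtain h where h: "continuous_map Z Y h"
    and h\<eta>: "\<And>x. x \<in> topspace X \<Longrightarrow> h (\<eta> x) = e x"
    using refl \<open>K Y\<close> unfolding reflection_in_def by metis
  \<comment> \<open>On the image of \<open>\<eta>\<close> the map \<open>h\<close> takes the values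
    of \<open>e\<close>, where \<open>f\<close> and \<open>g\<close> agree; uniqueness spreads this
    to all of \<open>Z\<close>.\<close>
  have "(f \<circ> h) z = (g \<circ> h) z" if "z \<in> topspace Z" for z
  proof (rule reflection_in_unique[OF refl \<open>K W\<close> _ _ _ that])
    show "continuous_map Z W (f \<circ> h)" "continuous_map Z W (g \<circ> h)"
      using f g h continuous_map_compose by blast+
  qed (use h\<eta> eq in auto)
  then have "h \<in> topspace Z \<rightarrow> e ` topspace X"
    using h eq by (auto simp: continuous_map_def)
  then have h': "continuous_map Z (subtopology Y (e ` topspace X)) h"
    using h by (simp add: continuous_map_in_subtopology image_subset_iff_funcset)
  obtain e' where e': "homeomorphic_maps X (subtopology Y (e ` topspace X)) e e'"
    using e by (auto simp: embedding_map_def homeomorphic_map_maps)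
  have r: "continuous_map Z X (e' \<circ> h)"
    using h' e' continuous_map_compose by (metis homeomorphic_maps_def)
  have r\<eta>: "(e' \<circ> h) (\<eta> x) = x" if "x \<in> topspace X" for x
    using that e' h\<eta> by (simp add: homeomorphic_maps_def)
  \<comment> \<open>The opposite composite is the identity on \<open>X\<close>, so this one fixes
    the image of \<open>\<eta>\<close>, and uniqueness makes it the identity.\<close>
  have "(\<eta> \<circ> (e' \<circ> h)) z = id z" if "z \<in> topspace Z" for z
  proof (rule reflection_in_unique[OF refl \<open>K Z\<close> _ _ _ that])
    show "continuous_map Z Z (\<eta> \<circ> (e' \<circ> h))"
      using r \<eta> continuous_map_compose by blast
  qed (use r\<eta> in auto)
  then have "homeomorphic_maps X Z \<eta> (e' \<circ> h)"
    using \<eta> r r\<eta> by (simp add: homeomorphic_maps_def)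
  then show ?thesis
    by (auto simp: homeomorphic_space_def)
qed

section \<open>Invariance under homeomorphism\<close>

lemma saturated_in_iff:
  "saturated_in X S \<longleftrightarrow> S \<subseteq> topspace X \<and>
    (\<forall>x \<in> topspace X - S. \<exists>U. openin X U \<and> S \<subseteq> U \<and> x \<notin> U)"
proof
  assume "saturated_in X S"
  then show "S \<subseteq> topspace X \<and> (\<forall>x \<in> topspace X - S. \<exists>U. openin X U \<and> S \<subseteq> U \<and> x \<notin> U)"
    unfolding saturated_in_def by blast
next
  assume *: "S \<subseteq> topspace X \<and> (\<forall>x \<in> topspace X - S. \<exists>U. openin X U \<and> S \<subseteq> U \<and> x \<notin> U)"
  then have "\<Inter> {U. openin X U \<and> S \<subseteq> U} \<subseteq> S"
    using openin_topspace by blast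
  then show "saturated_in X S"
    using * unfolding saturated_in_def by blast
qed

lemma saturated_in_homeomorphic_image:
  assumes h: "homeomorphic_map X Y h" and S: "saturated_in X S"
  shows "saturated_in Y (h ` S)"
  unfolding saturated_in_iff
proof (intro conjI ballI)
  have sub: "S \<subseteq> topspace X"
    using S by (simp add: saturated_in_def)
  have surj: "h ` topspace X = topspace Y" and inj: "inj_on h (topspace X)"
    using h by (auto simp: homeomorphic_eq_everything_map)
  show "h ` S \<subseteq> topspace Y"
    using sub surj by blast
  fix y assume "y \<in> topspace Y - h ` S"
  then obtain x where x: "x \<in> topspace X - S" "y = h x"
    using surj by blast
  then obtain U where U: "openin X U" "S \<subseteq> U" "x \<notin> U"
    using S unfolding saturated_in_iff by blast
  then have "U \<subseteq> topspace X"
    by (simp add: openin_subset)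
  then have "openin Y (h ` U)" "y \<notin> h ` U"
    using U x h inj homeomorphic_map_openness by (blast, auto dest: inj_onD)
  then show "\<exists>V. openin Y V \<and> h ` S \<subseteq> V \<and> y \<notin> V"
    using U by blast
qed

lemma compact_saturated_sets_homeomorphic_image:
  assumes h: "homeomorphic_map X Y h" and S: "S \<in> compact_saturated_sets X"
  shows "h ` S \<in> compact_saturated_sets Y"
proof -
  have "compactin Y (h ` S)"
    using h S by (auto simp: compact_saturated_sets_def homeomorphic_imp_continuous_map
        intro: image_compactin)
  then show ?thesis
    using assms saturated_in_homeomorphic_image by (auto simp: compact_saturated_sets_def)
qed

lemma strong_R_space_homeomorphic:
  assumes Y: "strong_R_space Y" and XY: "X homeomorphic_space Y"
  shows "strong_R_space X"
  unfolding strong_R_space_def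
proof (intro conjI allI impI)
  show "t0_space X"
    using assms homeomorphic_t0_space by (auto simp: strong_R_space_def)
  obtain h where h: "homeomorphic_map X Y h"
    using XY by (auto simp: homeomorphic_space)
  have inj: "inj_on h (topspace X)"
    using h by (auto simp: homeomorphic_eq_everything_map)
  fix \<K> U assume *: "\<K> \<noteq> {} \<and> \<K> \<subseteq> compact_saturated_sets X \<and> openin X U \<and> \<Inter>\<K> \<subseteq> U"
  have sub: "S \<subseteq> topspace X" if "S \<in> \<K>" for S
    using * that by (auto simp: compact_saturated_sets_def saturated_in_def)
  have U: "U \<subseteq> topspace X" "openin Y (h ` U)"
    using * h homeomorphic_map_openness openin_subset by blast+
  have "(`) h ` \<K> \<subseteq> compact_saturated_sets Y"
    using * h compact_saturated_sets_homeomorphic_image by blast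
  moreover have "\<Inter> ((`) h ` \<K>) = h ` (\<Inter>\<K>)"
    using image_INT[OF inj, of \<K> id] * sub by (auto simp: image_image)
  then have "\<Inter> ((`) h ` \<K>) \<subseteq> h ` U"
    using * by (simp add: image_mono)
  ultimately obtain \<G> where "\<G> \<noteq> {}" "finite \<G>" "\<G> \<subseteq> (`) h ` \<K>" "\<Inter>\<G> \<subseteq> h ` U"
    using Y U * unfolding strong_R_space_def by (metis image_is_empty)
  then obtain \<F> where \<F>: "\<F> \<noteq> {}" "finite \<F>" "\<F> \<subseteq> \<K>" "\<Inter> ((`) h ` \<F>) \<subseteq> h ` U"
    by (metis finite_subset_image image_is_empty)
  have "\<Inter>\<F> \<subseteq> U"
  proof
    fix x assume x: "x \<in> \<Inter>\<F>"
    then have "h x \<in> h ` U" "x \<in> topspace X"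
      using \<F> sub by blast+
    then show "x \<in> U"
      using inj U by (auto dest: inj_onD)
  qed
  then show "\<exists>\<F>. \<F> \<noteq> {} \<and> finite \<F> \<and> \<F> \<subseteq> \<K> \<and> \<Inter>\<F> \<subseteq> U"
    using \<F> by blast
qed

section \<open>The comb space\<close>

datatype point = Low nat | High nat | Lim

text \<open>Countability supplies the injection \<open>to_nat\<close>, through which the space is
  copied into arbitrary infinite types.\<close>

instance point :: countable
  by countable_datatype

text \<open>The points \<open>High n\<close> are isolated and form, together with
  \<open>Lim\<close>, the one-point compactification of a countable discrete space.\<close>

definition comb_open :: "point set \<Rightarrow> bool" where
  "comb_open U \<longleftrightarrow> (\<forall>i. Low i \<in> U \<longrightarrow> Lim \<in> U \<and> (\<forall>n>i. High n \<in> U)) \<and>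
    (Lim \<in> U \<longrightarrow> finite {n. High n \<notin> U})"

definition comb :: "point topology" where
  "comb = topology comb_open"

lemma openin_comb: "openin comb U \<longleftrightarrow> comb_open U"
proof -
  have "istopology comb_open"
    unfolding istopology_def
  proof (intro conjI allI impI)
    fix S T assume "comb_open S" "comb_open T"
    moreover have "{n. High n \<notin> S \<inter> T} = {n. High n \<notin> S} \<union> {n. High n \<notin> T}"
      by auto
    ultimately show "comb_open (S \<inter> T)"
      by (auto simp: comb_open_def)
  next
    fix \<U> assume *: "\<forall>U\<in>\<U>. comb_open U"
    have "finite {n. High n \<notin> \<Union>\<U>}" if "U \<in> \<U>" "Lim \<in> U" for U
      using * that by (auto simp: comb_open_def intro: rev_finite_subset[of "{n. High n \<notin> U}"])
    then show "comb_open (\<Union>\<U>)"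
      using * unfolding comb_open_def by blast
  qed
  then show ?thesis
    by (simp add: comb_def)
qed

lemma topspace_comb [simp]: "topspace comb = UNIV"
proof -
  have "openin comb UNIV"
    by (simp add: openin_comb comb_open_def)
  then show ?thesis
    using openin_subset by blast
qed

lemma openin_comb_High: "openin comb (High ` N)"
  by (auto simp: openin_comb comb_open_def)

lemma openin_comb_upper: "openin comb (Low ` I \<union> {Lim} \<union> range High)"
  by (auto simp: openin_comb comb_open_def)

lemma openin_comb_Low: "openin comb ({Low i, Lim} \<union> High ` {i<..})"
proof -
  have "{n. High n \<notin> {Low i, Lim} \<union> High ` {i<..}} = {..i}"
    by auto
  then show ?thesis
    by (auto simp: openin_comb comb_open_def)
qed

lemma t0_space_comb: "t0_space comb"
  unfolding t0_space_def
proof (intro ballI impI)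
  fix x y :: point assume "x \<noteq> y"
  then consider n where "x = High n \<or> y = High n" | i j where "x = Low i" "y = Low j" "i \<noteq> j"
    | "x = Lim" "y \<in> range Low" | "y = Lim" "x \<in> range Low"
    by (cases x; cases y) auto
  then show "\<exists>U. openin comb U \<and> (x \<notin> U) = (y \<in> U)"
  proof cases
    case (1 n)
    then show ?thesis
      using openin_comb_High[of "{n}"] \<open>x \<noteq> y\<close> by (intro exI[of _ "{High n}"]) auto
  next
    case (2 i j)
    then show ?thesis
      by (intro exI[of _ "Low ` {i} \<union> {Lim} \<union> range High"] conjI openin_comb_upper) auto
  qed (intro exI[of _ "Low ` {} \<union> {Lim} \<union> range High"] conjI openin_comb_upper; auto)+
qed

text \<open>Open sets with one \<open>Low\<close> point each cover \<open>K\<close>, so a finite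
  subcover bounds its \<open>Low\<close> part. Every neighbourhood of \<open>Low i\<close> contains
  \<open>Lim\<close>, so saturation brings in \<open>Lim\<close>. Without \<open>Lim\<close> there
  are then no \<open>Low\<close> points, and \<open>K\<close> consists of isolated points.\<close>

lemma compact_saturated_sets_comb:
  assumes "K \<in> compact_saturated_sets comb"
  shows "finite {i. Low i \<in> K}" and "Low i \<in> K \<Longrightarrow> Lim \<in> K"
    and "Lim \<notin> K \<Longrightarrow> finite {n. High n \<in> K}"
proof -
  have compact: "compactin comb K" and sat: "saturated_in comb K"
    using assms by (auto simp: compact_saturated_sets_def)
  show Lim: "Lim \<in> K" if "Low i \<in> K" for i
    using sat that unfolding saturated_in_iff openin_comb comb_open_def by auto
  let ?\<U> = "range (\<lambda>i. Low ` {i} \<union> {Lim} \<union> range High)"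
  have "K \<subseteq> \<Union>?\<U>"
  proof
    fix x show "x \<in> \<Union>?\<U>"
      by (cases x) auto
  qed
  then obtain \<F> where \<F>: "finite \<F>" "\<F> \<subseteq> ?\<U>" "K \<subseteq> \<Union>\<F>"
    using compactinD[OF compact, of ?\<U>] openin_comb_upper by blast
  then obtain I where I: "finite I" "\<F> = (\<lambda>i. Low ` {i} \<union> {Lim} \<union> range High) ` I"
    using finite_subset_image by meson
  have "{i. Low i \<in> K} \<subseteq> I"
  proof
    fix i assume "i \<in> {i. Low i \<in> K}"
    then obtain k where "k \<in> I" "Low i \<in> Low ` {k} \<union> {Lim} \<union> range High"
      using \<F>(3) I(2) by blast
    then show "i \<in> I"
      by auto
  qed
  then show "finite {i. Low i \<in> K}"
    using I(1) by (rule finite_subset)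
  show "finite {n. High n \<in> K}" if "Lim \<notin> K"
  proof -
    have "K \<subseteq> (\<Union>n. High ` {n})"
    proof
      fix x assume "x \<in> K"
      with that Lim show "x \<in> (\<Union>n. High ` {n})"
        by (cases x) auto
    qed
    then obtain \<F> where \<F>: "finite \<F>" "\<F> \<subseteq> range (\<lambda>n. High ` {n})" "K \<subseteq> \<Union>\<F>"
      using compactinD[OF compact, of "range (\<lambda>n. High ` {n})"] openin_comb_High by blast
    then obtain N where N: "finite N" "\<F> = (\<lambda>n. High ` {n}) ` N"
      using finite_subset_image by meson
    then have "{n. High n \<in> K} \<subseteq> N"
      using \<F>(3) by auto
    then show ?thesis
      using N(1) by (rule finite_subset)
  qed
qed

section \<open>The strong R-property with and without the limit point\<close>

lemma strong_R_space_comb: "strong_R_space comb"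
  unfolding strong_R_space_def
proof (intro conjI allI impI t0_space_comb)
  fix \<K> U assume *: "\<K> \<noteq> {} \<and> \<K> \<subseteq> compact_saturated_sets comb \<and> openin comb U \<and> \<Inter>\<K> \<subseteq> U"
  \<comment> \<open>If \<open>Lim\<close> is outside \<open>U\<close>, some member of
    \<open>\<K>\<close> omits it; otherwise any member serves.\<close>
  obtain K where K: "K \<in> \<K>" "Lim \<in> K \<Longrightarrow> Lim \<in> U"
    using * by blast
  then have KQ: "K \<in> compact_saturated_sets comb"
    using * by blast
  \<comment> \<open>Either \<open>U\<close> contains \<open>Lim\<close> and hence almost all
    \<open>High n\<close>, or \<open>K\<close> omits \<open>Lim\<close> and has only finitely many
    of them.\<close>
  have "finite {n. High n \<in> K - U}"
  proof (cases "Lim \<in> U")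
    case True
    then show ?thesis
      using * by (auto simp: openin_comb comb_open_def
          intro: rev_finite_subset[of "{n. High n \<notin> U}"])
  next
    case False
    then show ?thesis
      using K compact_saturated_sets_comb(3)[OF KQ]
      by (auto intro: rev_finite_subset[of "{n. High n \<in> K}"])
  qed
  moreover have "K - U \<subseteq> Low ` {i. Low i \<in> K} \<union> High ` {n. High n \<in> K - U} \<union> {Lim}"
  proof
    fix x assume "x \<in> K - U"
    then show "x \<in> Low ` {i. Low i \<in> K} \<union> High ` {n. High n \<in> K - U} \<union> {Lim}"
      by (cases x) auto
  qed
  ultimately have fin: "finite (K - U)"
    using compact_saturated_sets_comb(1)[OF KQ]
    by (meson finite.intros finite_UnI finite_imageI finite_subset)
  \<comment> \<open>Each of the finitely many points of \<open>K - U\<close> lies outside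
    \<open>\<Inter>\<K>\<close>, so one member of \<open>\<K>\<close> per point removes it.\<close>
  have "\<forall>x \<in> K - U. \<exists>S. S \<in> \<K> \<and> x \<notin> S"
    using * by blast
  then obtain S where S: "\<forall>x \<in> K - U. S x \<in> \<K> \<and> x \<notin> S x"
    by metis
  have "finite (insert K (S ` (K - U)))"
    using fin by simp
  moreover have "insert K (S ` (K - U)) \<subseteq> \<K>" "\<Inter> (insert K (S ` (K - U))) \<subseteq> U"
    using K S by blast+
  ultimately show "\<exists>\<F>. \<F> \<noteq> {} \<and> finite \<F> \<and> \<F> \<subseteq> \<K> \<and> \<Inter>\<F> \<subseteq> U"
    by (metis insert_not_empty)
qed

lemma not_strong_R_space_comb_without_Lim: "\<not> strong_R_space (subtopology comb (- {Lim}))"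
proof
  let ?E = "subtopology comb (- {Lim})"
  let ?K = "\<lambda>i. {Low i} \<union> High ` {i<..}"
  assume E: "strong_R_space ?E"
  have open_K: "openin ?E (?K i)" for i
  proof -
    have "({Low i, Lim} \<union> High ` {i<..}) \<inter> - {Lim} = ?K i"
      by auto
    then show ?thesis
      using openin_subtopology_Int[OF openin_comb_Low[of i], of "- {Lim}"] by simp
  qed
  have "?K i \<in> compact_saturated_sets ?E" for i
  proof -
    \<comment> \<open>\<open>?K i\<close> is the least neighbourhood of \<open>Low i\<close> in the
      subspace, so a single member of an open cover already contains it.\<close>
    have *: "?K i \<subseteq> U" if "openin ?E U" "Low i \<in> U" for U
      using that by (auto simp: openin_subtopology openin_comb comb_open_def)
    have "compactin ?E (?K i)"
      unfolding compactin_def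
    proof (intro conjI allI impI)
      show "?K i \<subseteq> topspace ?E"
        by auto
      fix \<U> assume \<U>: "Ball \<U> (openin ?E) \<and> ?K i \<subseteq> \<Union>\<U>"
      then obtain U where "U \<in> \<U>" "Low i \<in> U"
        by auto
      then show "\<exists>\<F>. finite \<F> \<and> \<F> \<subseteq> \<U> \<and> ?K i \<subseteq> \<Union>\<F>"
        using \<U> * by (intro exI[of _ "{U}"]) auto
    qed
    moreover have "saturated_in ?E (?K i)"
      using open_K[of i] openin_subset unfolding saturated_in_iff by blast
    ultimately show ?thesis
      by (simp add: compact_saturated_sets_def)
  qed
  moreover have "\<Inter> (range ?K) = {}"
  proof -
    \<comment> \<open>\<open>Low i\<close> lies in \<open>?K i\<close> only, and \<open>?K n\<close>
      misses \<open>High n\<close> because its bound is strict. \<open>Lim\<close> is in no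
      \<open>?K i\<close>, so the value \<open>0\<close> is arbitrary.\<close>
    have "x \<notin> ?K (case x of Low i \<Rightarrow> Suc i | High n \<Rightarrow> n | Lim \<Rightarrow> 0)" for x
      by (cases x) auto
    then show ?thesis
      by blast
  qed
  ultimately obtain \<F> where \<F>: "\<F> \<noteq> {}" "finite \<F>" "\<F> \<subseteq> range ?K" "\<Inter>\<F> \<subseteq> {}"
    using E unfolding strong_R_space_def
    by (metis (no_types, lifting) UNIV_not_empty image_is_empty image_subsetI openin_empty order_refl)
  then obtain I where I: "finite I" "\<F> = ?K ` I"
    by (metis (no_types, lifting) finite_subset_image)
  \<comment> \<open>The index exceeds all of \<open>I\<close>, so this point lies in every chosen
    set, although their intersection is empty.\<close>
  have "High (Suc (Max I)) \<in> ?K i" if "i \<in> I" for i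
    using Max_ge[OF I(1) that] by auto
  then show False
    using I \<F> by blast
qed

text \<open>
  In the image, \<open>Low 0\<close> and \<open>High 1\<close> form a Sierpinski space, so the continuous maps below
  are the characteristic functions of open sets.
\<close>

lemma continuous_map_comb_indicator:
  assumes "openin comb V"
  shows "continuous_map comb comb (\<lambda>x. if x \<in> V then High 1 else Low 0)"
  unfolding continuous_map_def
proof (intro conjI allI impI)
  fix U assume "openin comb U"
  \<comment> \<open>\<open>High 1\<close> and not \<open>High 0\<close>, since the least
    neighbourhood of \<open>Low 0\<close> has \<open>High n\<close> only for \<open>n > 0\<close>.
    This excludes a \<open>U\<close> with \<open>Low 0\<close> but not \<open>High 1\<close>, whose
    preimage would be the complement of \<open>V\<close>.\<close>
  then have "Low 0 \<in> U \<Longrightarrow> High 1 \<in> U"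
    by (simp add: openin_comb comb_open_def)
  then have "{x. (if x \<in> V then High 1 else Low 0) \<in> U} \<in> {{}, V, topspace comb}"
    by auto
  then show "openin comb {x \<in> topspace comb. (if x \<in> V then High 1 else Low 0) \<in> U}"
    using assms openin_topspace[of comb]
    by (elim insertE emptyE) (simp_all only: openin_empty topspace_comb UNIV_I simp_thms)
qed simp

section \<open>Transfer to arbitrary infinite types\<close>

text \<open>The copy is the pullback along \<open>inv j\<close> to the image of the carrier; it
  moves spaces of points into the types of the theorem.\<close>

lemma homeomorphic_copy:
  fixes j :: "'a \<Rightarrow> 'b"
  assumes "inj j"
  obtains Y where "homeomorphic_map X Y j"
proof -
  let ?Y = "pullback_topology (j ` topspace X) (inv j) X"
  have "inv j \<circ> j = id"
    using assms by simp
  then have "continuous_map X ?Y j"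
    by (intro continuous_map_pullback') auto
  moreover have "continuous_map ?Y X (inv j)"
    using continuous_map_pullback[OF continuous_map_id[of X]] by simp
  ultimately have "homeomorphic_maps X ?Y j (inv j)"
    using assms by (auto simp: homeomorphic_maps_def topspace_pullback_topology)
  then have "homeomorphic_map X ?Y j"
    using homeomorphic_maps_map by blast
  then show ?thesis
    using that by blast
qed

theorem theorem5p6:
  assumes "infinite (UNIV :: 'a set)" and "infinite (UNIV :: 'u set)"
  shows "\<not> reflective_in_Top0 TYPE('a) (strong_R_space :: 'u topology \<Rightarrow> bool)"
proof
  assume refl: "reflective_in_Top0 TYPE('a) (strong_R_space :: 'u topology \<Rightarrow> bool)"
  obtain a :: "nat \<Rightarrow> 'a" and u :: "nat \<Rightarrow> 'u" where "inj a" "inj u"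
    using assms infinite_countable_subset by meson
  then have "inj (a \<circ> to_nat :: point \<Rightarrow> 'a)" "inj (u \<circ> to_nat :: point \<Rightarrow> 'u)"
    by (simp_all add: inj_compose)
  let ?E = "subtopology comb (- {Lim})"
  \<comment> \<open>The space to be reflected is a copy of the subspace over \<open>'a\<close>; the
    ambient space is copied over \<open>'u\<close> to become an object of the subcategory.\<close>
  obtain X :: "'a topology" and p where p: "homeomorphic_map ?E X p"
    using homeomorphic_copy \<open>inj (a \<circ> to_nat)\<close> by blast
  obtain Y :: "'u topology" and q where q: "homeomorphic_map comb Y q"
    using homeomorphic_copy \<open>inj (u \<circ> to_nat)\<close> by blast
  have Y: "strong_R_space Y"
    using strong_R_space_comb strong_R_space_homeomorphic q homeomorphic_space homeomorphic_space_sym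
    by blast
  have EX: "?E homeomorphic_space X"
    using p homeomorphic_space by blast
  have "t0_space X"
    using EX t0_space_comb t0_space_subtopology homeomorphic_t0_space by blast
  then obtain Z :: "'u topology" and \<eta> where Z: "reflection_in strong_R_space X Z \<eta>"
    using refl by (auto simp: reflective_in_Top0_def)
  obtain p' where p': "homeomorphic_maps ?E X p p'"
    using p homeomorphic_map_maps by blast
  obtain q' where q': "homeomorphic_maps comb Y q q'"
    using q homeomorphic_map_maps by blast
  \<comment> \<open>Taking for \<open>V\<close> the set of all \<open>High n\<close>, and that set
    with \<open>Lim\<close> added, gives two maps that differ exactly at the copy of
    \<open>Lim\<close>.\<close>
  let ?f = "\<lambda>V. q \<circ> (\<lambda>x. if x \<in> V then High 1 else Low 0) \<circ> q'"
  have f: "continuous_map Y Y (?f V)" if "openin comb V" for V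
    using q' continuous_map_comb_indicator[OF that]
    by (auto simp: homeomorphic_maps_def intro!: continuous_map_compose)
  have inj_q: "q x = q y \<longleftrightarrow> x = y" and q'q: "q' (q x) = x" for x y
    using q' by (auto simp: homeomorphic_maps_def) metis
  have "X homeomorphic_space Z"
  proof (rule reflection_in_equalizer_homeomorphic[OF Z Y Y])
    have "homeomorphic_map X ?E p'"
      using p' homeomorphic_maps_map by blast
    then have "embedding_map X comb p'"
      by (metis embedding_map_in_subtopology surjective_embedding_map)
    then show "embedding_map X Y (q \<circ> p')"
      using q by (meson embedding_map_compose surjective_embedding_map)
    show "continuous_map Y Y (?f (range High))"
      using f openin_comb_High by blast
    show "continuous_map Y Y (?f (Low ` {} \<union> {Lim} \<union> range High))"
      using f openin_comb_upper by blast
    have "?f (range High) (q x) = ?f (Low ` {} \<union> {Lim} \<union> range High) (q x)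
        \<longleftrightarrow> x \<in> - {Lim}" for x
      by (cases x) (auto simp: q'q inj_q)
    moreover have "{y \<in> range q. P y} = q ` {x. P (q x)}" for P
      by blast
    moreover have "topspace Y = range q"
      using q homeomorphic_imp_surjective_map by fastforce
    ultimately have "{y \<in> topspace Y. ?f (range High) y =
        ?f (Low ` {} \<union> {Lim} \<union> range High) y} = q ` (- {Lim})"
      by (simp only: Collect_mem_eq)
    moreover have "p' ` topspace X = - {Lim}"
      using \<open>homeomorphic_map X ?E p'\<close> homeomorphic_imp_surjective_map by fastforce
    ultimately show "(q \<circ> p') ` topspace X = {y \<in> topspace Y. ?f (range High) y =
        ?f (Low ` {} \<union> {Lim} \<union> range High) y}"
      by (simp only: image_comp[symmetric])
  qed
  then have "?E homeomorphic_space Z"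
    using EX homeomorphic_space_trans by blast
  moreover have "strong_R_space Z"
    using Z by (simp add: reflection_in_def)
  ultimately show False
    using strong_R_space_homeomorphic not_strong_R_space_comb_without_Lim by blast
qed

end
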